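(* Let $\mathbb{P}$ and $\mathbb{Q}$ be probability measures on a filtered space $(\Omega,\mathscr{F},(\mathscr{F}_t))$ and let $(Z_t)$ be a càdlàg, adapted, non-negative process such that $\mathbb{Q}|_{\mathscr{F}_t}=Z_t\,\mathbb{P}|_{\mathscr{F}_t}$ for every $t$. Then for all times $s,t$, \[\mathbb{E}_{\mathbb{Q}}\left[\left.\frac{1}{Z_{t+s}}\,\right|\,\mathscr{F}_t\right]=\frac{1}{Z_t}\,\mathbb{P}(Z_{t+s}>0\mid\mathscr{F}_t)\qquad \mathbb{Q}\text{-almost surely}.\] In particular, $(1/Z_t)$ is a $\mathbb{Q}$-supermartingale.
   Context: Time may be continuous ($t\in\mathbb{R}_+$) or discrete ($t\in\mathbb{Z}_+$; then the càdlàg requirement is void). The relation $\mathbb{Q}|_{\mathscr{F}_t}=Z_t\,\mathbb{P}|_{\mathscr{F}_t}$ means $\mathbb{Q}(A)=\mathbb{E}_{\mathbb{P}}[Z_t\mathbf{1}_A]$ for all $A\in\mathscr{F}_t$; here $Z$ takes values in $[0,\infty)$. $\mathbb{E}_{\mathbb{P}},\mathbb{E}_{\mathbb{Q}}$ denote expectations under $\mathbb{P},\mathbb{Q}$. For each $t$ the event $\{Z_t=0\}$ is $\mathbb{Q}$-null, so $1/Z_t$ is defined $\mathbb{Q}$-almost surely (its value on $\{Z_t=0\}$ is irrelevant under $\mathbb{Q}$). *)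

theory Defs
  imports "HOL-Probability.Probability"
begin

text \<open>
  A time set is a set \<open>T\<close> of reals, to be instantiated with \<open>{0..}\<close> (continuous time) or
  \<open>\<nat>\<close> (discrete time). Families indexed by time are functions on the reals of which only
  the values on \<open>T\<close> matter.
\<close>

definition filtration_on :: "real set \<Rightarrow> 'a measure \<Rightarrow> (real \<Rightarrow> 'a measure) \<Rightarrow> bool" where
  "filtration_on T M F \<longleftrightarrow>
     (\<forall>t\<in>T. subalgebra M (F t)) \<and>
     (\<forall>s\<in>T. \<forall>t\<in>T. s \<le> t \<longrightarrow> sets (F s) \<subseteq> sets (F t))"

definition adapted_on :: "real set \<Rightarrow> (real \<Rightarrow> 'a measure) \<Rightarrow> (real \<Rightarrow> 'a \<Rightarrow> real) \<Rightarrow> bool" where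
  "adapted_on T F X \<longleftrightarrow> (\<forall>t\<in>T. X t \<in> borel_measurable (F t))"

text \<open>
  Limits are taken along \<open>T\<close>. At a point isolated from the relevant side (every point of \<open>\<nat>\<close>,
  and \<open>0\<close> from the left) the filter is trivial and the condition is void.
\<close>

definition cadlag_on :: "real set \<Rightarrow> (real \<Rightarrow> real) \<Rightarrow> bool" where
  "cadlag_on T f \<longleftrightarrow>
     (\<forall>t\<in>T. (f \<longlongrightarrow> f t) (at t within (T \<inter> {t<..})) \<and>
            (\<exists>l. (f \<longlongrightarrow> l) (at t within (T \<inter> {..<t}))))"

definition supermartingale_on ::
    "real set \<Rightarrow> 'a measure \<Rightarrow> (real \<Rightarrow> 'a measure) \<Rightarrow> (real \<Rightarrow> 'a \<Rightarrow> real) \<Rightarrow> bool" where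
  "supermartingale_on T M F X \<longleftrightarrow>
     adapted_on T F X \<and>
     (\<forall>t\<in>T. integrable M (X t)) \<and>
     (\<forall>s\<in>T. \<forall>t\<in>T. s \<le> t \<longrightarrow> (AE \<omega> in M. real_cond_exp M (F s) (X t) \<omega> \<le> X s \<omega>))"

end

theory Submission
  imports Defs
begin

text \<open>
  On \<open>\<F>\<^sub>t\<close> the measure \<open>Q\<close> is \<open>Z\<^sub>t\<close> times \<open>P\<close>, so every \<open>\<F>\<^sub>t\<close>-measurable integrand \<open>f\<close>
  satisfies \<open>E\<^sub>Q[f] = E\<^sub>P[Z\<^sub>t f]\<close> (\<open>integral_eq\<close>). Let \<open>u \<ge> t\<close> and \<open>A \<in> \<F>\<^sub>t\<close>.

  Changing measure on \<open>\<F>\<^sub>u\<close> cancels the density where it is positive: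
  \<open>E\<^sub>Q[1\<^sub>A / Z\<^sub>u] = P(A \<inter> {Z\<^sub>u > 0})\<close>. For \<open>A = \<Omega>\<close> this also shows that \<open>1 / Z\<^sub>u\<close> is
  \<open>Q\<close>-integrable. With \<open>W = P(Z\<^sub>u > 0 | \<F>\<^sub>t)\<close>, changing measure on \<open>\<F>\<^sub>t\<close> gives
  \<open>E\<^sub>Q[1\<^sub>A W / Z\<^sub>t] = E\<^sub>P[1\<^sub>A 1\<^bsub>{Z\<^sub>t > 0}\<^esub> W] = P(A \<inter> {Z\<^sub>t > 0} \<inter> {Z\<^sub>u > 0})\<close>. The two
  right-hand sides agree because the density process does not leave zero
  (\<open>density_absorbed_at_zero\<close>): as \<open>Q(Z\<^sub>t = 0) = 0\<close>, the integral of \<open>Z\<^sub>u\<close> over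
  \<open>{Z\<^sub>t = 0}\<close> vanishes, so \<open>Z\<^sub>u > 0\<close> implies \<open>Z\<^sub>t > 0\<close> up to a \<open>P\<close>-null set. Hence \<open>W / Z\<^sub>t\<close> has
  the defining property of \<open>E\<^sub>Q[1 / Z\<^sub>u | \<F>\<^sub>t]\<close>, and \<open>W \<le> 1\<close> yields the supermartingale
  inequality.
\<close>

section \<open>Change of measure on a sub-sigma-algebra\<close>

locale density_on_subalgebra =
  fixes P Q G :: "'a measure" and Z :: "'a \<Rightarrow> real"
  assumes sets_eq: "sets Q = sets P"
    and subalg_P: "subalgebra P G"
    and measurable_Z [measurable]: "Z \<in> borel_measurable G"
    and Z_nonneg: "\<And>\<omega>. \<omega> \<in> space P \<Longrightarrow> 0 \<le> Z \<omega>"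
    and emeasure_eq:
      "\<And>A. A \<in> sets G \<Longrightarrow> emeasure Q A = (\<integral>\<^sup>+\<omega>. ennreal (Z \<omega>) * indicator A \<omega> \<partial>P)"
begin

lemma space_eq: "space Q = space P"
  using sets_eq by (rule sets_eq_imp_space_eq)

lemma subalg_Q: "subalgebra Q G"
  using subalg_P by (simp add: subalgebra_def sets_eq space_eq)

lemma restr_eq_density: "restr_to_subalg Q G = density (restr_to_subalg P G) Z"
proof (rule measure_eqI)
  show "sets (restr_to_subalg Q G) = sets (density (restr_to_subalg P G) Z)"
    by (simp add: sets_restr_to_subalg subalg_P subalg_Q)
next
  fix A assume "A \<in> sets (restr_to_subalg Q G)"
  then have A [measurable]: "A \<in> sets G"
    by (simp add: sets_restr_to_subalg subalg_Q)
  have "emeasure (density (restr_to_subalg P G) Z) A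
      = (\<integral>\<^sup>+\<omega>. ennreal (Z \<omega>) * indicator A \<omega> \<partial>restr_to_subalg P G)"
    by (rule emeasure_density)
      (auto simp: sets_restr_to_subalg subalg_P A intro!: measurable_in_subalg)
  also have "\<dots> = emeasure Q A"
    by (simp add: nn_integral_subalgebra2 subalg_P emeasure_eq A)
  finally show "emeasure (restr_to_subalg Q G) A = emeasure (density (restr_to_subalg P G) Z) A"
    by (simp add: emeasure_restr_to_subalg subalg_Q A)
qed

lemma integrable_restr_iff:
  fixes f :: "'a \<Rightarrow> real"
  assumes "subalgebra M G" and "f \<in> borel_measurable G"
  shows "integrable (restr_to_subalg M G) f \<longleftrightarrow> integrable M f"
  using assms integrable_from_subalg integrable_in_subalg by blast

lemma AE_restr_density_nonneg: "AE \<omega> in restr_to_subalg P G. 0 \<le> Z \<omega>"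
  by (rule AE_I2) (simp add: space_restr_to_subalg Z_nonneg)

lemma integrable_iff:
  fixes f :: "'a \<Rightarrow> real"
  assumes f [measurable]: "f \<in> borel_measurable G"
  shows "integrable Q f \<longleftrightarrow> integrable P (\<lambda>\<omega>. Z \<omega> * f \<omega>)"
proof -
  have "integrable Q f \<longleftrightarrow> integrable (density (restr_to_subalg P G) Z) f"
    using integrable_restr_iff[OF subalg_Q f] by (simp add: restr_eq_density)
  also have "\<dots> \<longleftrightarrow> integrable (restr_to_subalg P G) (\<lambda>\<omega>. Z \<omega> * f \<omega>)"
    by (subst integrable_density)
      (auto intro!: measurable_in_subalg subalg_P AE_restr_density_nonneg)
  also have "\<dots> \<longleftrightarrow> integrable P (\<lambda>\<omega>. Z \<omega> * f \<omega>)"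
    by (rule integrable_restr_iff[OF subalg_P]) measurable
  finally show ?thesis .
qed

lemma integral_eq:
  fixes f :: "'a \<Rightarrow> real"
  assumes f [measurable]: "f \<in> borel_measurable G"
  shows "(\<integral>\<omega>. f \<omega> \<partial>Q) = (\<integral>\<omega>. Z \<omega> * f \<omega> \<partial>P)"
proof -
  have "(\<integral>\<omega>. f \<omega> \<partial>Q) = (\<integral>\<omega>. f \<omega> \<partial>density (restr_to_subalg P G) Z)"
    using integral_subalgebra2[OF subalg_Q f] by (simp add: restr_eq_density)
  also have "\<dots> = (\<integral>\<omega>. Z \<omega> * f \<omega> \<partial>restr_to_subalg P G)"
    by (subst integral_density)
      (auto intro!: measurable_in_subalg subalg_P AE_restr_density_nonneg)
  also have "\<dots> = (\<integral>\<omega>. Z \<omega> * f \<omega> \<partial>P)"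
    by (rule integral_subalgebra2[OF subalg_P]) measurable
  finally show ?thesis .
qed

text \<open>
  \<open>Q\<close> is absolutely continuous with respect to \<open>P\<close> on \<open>G\<close> only: a \<open>P\<close>-null set outside
  \<open>G\<close> may be charged by \<open>Q\<close>, whence the measurability assumption.
\<close>

lemma AE_transfer:
  assumes R [measurable]: "Measurable.pred G R" and "AE \<omega> in P. R \<omega>"
  shows "AE \<omega> in Q. R \<omega>"
proof (rule AE_restr_to_subalg[OF subalg_Q])
  have "AE \<omega> in restr_to_subalg P G. R \<omega>"
    by (rule AE_restr_to_subalg2[OF subalg_P assms(2) R])
  then show "AE \<omega> in restr_to_subalg Q G. R \<omega>"
    unfolding restr_eq_density
    by (subst AE_density) (auto intro!: measurable_in_subalg subalg_P)
qed

lemma zero_set_in_G: "{\<omega> \<in> space P. Z \<omega> = 0} \<in> sets G"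
proof -
  have "space P = space G"
    using subalg_P by (simp add: subalgebra_def)
  then show ?thesis
    by simp
qed

lemma emeasure_zero_set: "emeasure Q {\<omega> \<in> space P. Z \<omega> = 0} = 0"
proof -
  have "(\<lambda>\<omega>. ennreal (Z \<omega>) * indicator {\<omega> \<in> space P. Z \<omega> = 0} \<omega>) = (\<lambda>\<omega>. 0)"
    by (auto simp: fun_eq_iff split: split_indicator)
  then show ?thesis
    using emeasure_eq[OF zero_set_in_G] by simp
qed

lemma integrable_inverse_density:
  assumes "finite_measure P"
  shows "integrable Q (\<lambda>\<omega>. 1 / Z \<omega>)"
proof -
  interpret finite_measure P by fact
  have [measurable]: "Z \<in> borel_measurable P"
    by (rule measurable_from_subalg[OF subalg_P measurable_Z])
  have "integrable P (\<lambda>\<omega>. Z \<omega> * (1 / Z \<omega>))"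
    by (rule integrable_const_bound[where B = 1]) auto
  then show ?thesis
    by (subst integrable_iff) auto
qed

end

section \<open>Conditional expectation of an inverse density\<close>

text \<open>
  \<open>Q(Y = 0) = 0\<close> because \<open>Y\<close> is a density, and computing the same probability with the finer
  density \<open>Z\<close> shows that \<open>Z\<close> has integral zero over \<open>{Y = 0}\<close>.
\<close>

lemma density_absorbed_at_zero:
  assumes Y: "density_on_subalgebra P Q G Y" and Z: "density_on_subalgebra P Q H Z"
    and le: "sets G \<subseteq> sets H"
  shows "AE \<omega> in P. 0 < Z \<omega> \<longrightarrow> 0 < Y \<omega>"
proof -
  interpret Y: density_on_subalgebra P Q G Y by fact
  interpret Z: density_on_subalgebra P Q H Z by fact
  let ?N = "{\<omega> \<in> space P. Y \<omega> = 0}"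
  have N: "?N \<in> sets H"
    using Y.zero_set_in_G le by blast
  then have [measurable]: "?N \<in> sets P"
    using Z.subalg_P by (auto simp: subalgebra_def)
  have [measurable]: "Z \<in> borel_measurable P"
    by (rule measurable_from_subalg[OF Z.subalg_P Z.measurable_Z])
  have "(\<integral>\<^sup>+\<omega>. ennreal (Z \<omega>) * indicator ?N \<omega> \<partial>P) = 0"
    using Z.emeasure_eq[OF N] Y.emeasure_zero_set by simp
  then have "AE \<omega> in P. ennreal (Z \<omega>) * indicator ?N \<omega> = 0"
    by (subst (asm) nn_integral_0_iff_AE) simp_all
  then show ?thesis
  proof (rule AE_mp[OF _ AE_I2], intro impI)
    fix \<omega> assume "\<omega> \<in> space P" "ennreal (Z \<omega>) * indicator ?N \<omega> = 0" "0 < Z \<omega>"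
    then show "0 < Y \<omega>"
      using Y.Z_nonneg[of \<omega>] by (auto simp: less_le)
  qed
qed

text \<open>
  Over each set of \<open>G\<close>, the conditional expectation and its claimed value have the same
  \<open>Q\<close>-integral: a change of measure turns the two integrals into the \<open>P\<close>-probabilities of the
  same event, up to the \<open>P\<close>-null set where \<open>Z > 0\<close> but \<open>Y = 0\<close>.
\<close>

lemma cond_exp_inverse_density:
  assumes P: "prob_space P" and Q: "prob_space Q"
    and Y: "density_on_subalgebra P Q G Y" and Z: "density_on_subalgebra P Q H Z"
    and le: "sets G \<subseteq> sets H"
  shows "AE \<omega> in Q. real_cond_exp Q G (\<lambda>\<omega>. 1 / Z \<omega>) \<omega> =
           1 / Y \<omega> * real_cond_exp P G (indicator {\<omega> \<in> space P. 0 < Z \<omega>}) \<omega>"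
proof -
  interpret P: prob_space P by fact
  interpret Q: prob_space Q by fact
  interpret Y: density_on_subalgebra P Q G Y by fact
  interpret Z: density_on_subalgebra P Q H Z by fact
  interpret PG: finite_measure_subalgebra P G
    by unfold_locales (rule Y.subalg_P)
  interpret QG: finite_measure_subalgebra Q G
    by unfold_locales (rule Y.subalg_Q)
  have [measurable]: "Z \<in> borel_measurable P" "Y \<in> borel_measurable P"
    using measurable_from_subalg[OF Z.subalg_P Z.measurable_Z]
      measurable_from_subalg[OF Y.subalg_P Y.measurable_Z] .
  note Y.measurable_Z [measurable] Z.measurable_Z [measurable]
  define D :: "'a \<Rightarrow> real" where "D = indicator {\<omega> \<in> space P. 0 < Z \<omega>}"
  define W where "W = real_cond_exp P G D"
  have [measurable]: "W \<in> borel_measurable G" "W \<in> borel_measurable P" "D \<in> borel_measurable P"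
    unfolding W_def D_def by measurable
  have ZD: "Z \<omega> * (1 / Z \<omega>) = D \<omega>" if "\<omega> \<in> space P" for \<omega>
    using that Z.Z_nonneg[OF that] by (auto simp: D_def split: split_indicator)
  have int_D: "integrable P (\<lambda>\<omega>. g \<omega> * D \<omega>)"
    if "g \<in> borel_measurable P" "\<And>\<omega>. \<bar>g \<omega>\<bar> \<le> 1" for g
    using that by (intro P.integrable_const_bound[where B = 1])
      (auto simp: D_def abs_mult split: split_indicator)
  \<comment> \<open>As \<open>x / 0 = 0\<close>, this is the indicator of \<open>{Y > 0}\<close>, in the form that a change of
    measure produces.\<close>
  define pos :: "'a \<Rightarrow> real" where "pos \<omega> = Y \<omega> * (1 / Y \<omega>)" for \<omega>
  have pos_le: "\<bar>pos \<omega>\<bar> \<le> 1" for \<omega>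
    by (simp add: pos_def)
  have [measurable]: "pos \<in> borel_measurable G" "pos \<in> borel_measurable P"
    unfolding pos_def by measurable
  have W_int: "integrable Q (\<lambda>\<omega>. 1 / Y \<omega> * W \<omega>)"
  proof (subst Y.integrable_iff)
    have "integrable P (\<lambda>\<omega>. pos \<omega> * W \<omega>)"
      unfolding W_def by (rule PG.real_cond_exp_intg) (auto intro!: int_D pos_le)
    then show "integrable P (\<lambda>\<omega>. Y \<omega> * (1 / Y \<omega> * W \<omega>))"
      by (simp only: pos_def mult.assoc)
  qed measurable
  have "AE \<omega> in Q. real_cond_exp Q G (\<lambda>\<omega>. 1 / Z \<omega>) \<omega> = 1 / Y \<omega> * W \<omega>"
  proof (rule QG.real_cond_exp_charact)
    show "integrable Q (\<lambda>\<omega>. 1 / Z \<omega>)"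
      by (rule Z.integrable_inverse_density) unfold_locales
    show "integrable Q (\<lambda>\<omega>. 1 / Y \<omega> * W \<omega>)" by (rule W_int)
    show "(\<lambda>\<omega>. 1 / Y \<omega> * W \<omega>) \<in> borel_measurable G" by measurable
  next
    fix A assume A [measurable]: "A \<in> sets G"
    have AH [measurable]: "A \<in> sets H" using A le by blast
    have AP [measurable]: "A \<in> sets P" using A Y.subalg_P by (auto simp: subalgebra_def)
    let ?A = "indicator A :: 'a \<Rightarrow> real"
    have "(\<integral>\<omega>\<in>A. 1 / Z \<omega> \<partial>Q) = (\<integral>\<omega>. Z \<omega> * (?A \<omega> * (1 / Z \<omega>)) \<partial>P)"
      unfolding set_lebesgue_integral_def by (simp only: real_scaleR_def) (rule Z.integral_eq, measurable)
    also have "\<dots> = (\<integral>\<omega>. ?A \<omega> * D \<omega> \<partial>P)"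
      by (rule Bochner_Integration.integral_cong) (auto simp: ZD[symmetric])
    also have "\<dots> = (\<integral>\<omega>. (?A \<omega> * pos \<omega>) * D \<omega> \<partial>P)"
    proof (rule integral_cong_AE)
      show "AE \<omega> in P. ?A \<omega> * D \<omega> = (?A \<omega> * pos \<omega>) * D \<omega>"
        using density_absorbed_at_zero[OF Y Z le]
        by eventually_elim (auto simp: D_def pos_def split: split_indicator)
    qed measurable
    also have "\<dots> = (\<integral>\<omega>. (?A \<omega> * pos \<omega>) * W \<omega> \<partial>P)"
      unfolding W_def
      by (rule PG.real_cond_exp_intg(2)[symmetric])
        (auto intro!: int_D simp: pos_le split: split_indicator)
    also have "\<dots> = (\<integral>\<omega>. Y \<omega> * (?A \<omega> * (1 / Y \<omega> * W \<omega>)) \<partial>P)"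
      by (simp only: pos_def mult_ac)
    also have "\<dots> = (\<integral>\<omega>\<in>A. 1 / Y \<omega> * W \<omega> \<partial>Q)"
      unfolding set_lebesgue_integral_def
      by (simp only: real_scaleR_def) (rule Y.integral_eq[symmetric], measurable)
    finally show "(\<integral>\<omega>\<in>A. 1 / Z \<omega> \<partial>Q) = (\<integral>\<omega>\<in>A. 1 / Y \<omega> * W \<omega> \<partial>Q)" .
  qed
  then show ?thesis
    by (simp add: W_def D_def)
qed

section \<open>The inverse density process\<close>

theorem proposition2:
  fixes P Q :: "'a measure"
    and T :: "real set"
    and F :: "real \<Rightarrow> 'a measure"
    and Z :: "real \<Rightarrow> 'a \<Rightarrow> real"
  assumes time: "T = {0..} \<or> T = \<nat>"
    and P: "prob_space P"
    and Q: "prob_space Q"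
    and sets_eq: "sets Q = sets P"
    and filtration: "filtration_on T P F"
    and adapted: "adapted_on T F Z"
    and nonneg: "\<forall>t\<in>T. \<forall>\<omega>\<in>space P. 0 \<le> Z t \<omega>"
    and cadlag: "\<forall>\<omega>\<in>space P. cadlag_on T (\<lambda>t. Z t \<omega>)"
    and density: "\<forall>t\<in>T. \<forall>A\<in>sets (F t).
      emeasure Q A = (\<integral>\<^sup>+\<omega>. ennreal (Z t \<omega>) * indicator A \<omega> \<partial>P)"
  shows "(\<forall>s\<in>T. \<forall>t\<in>T. AE \<omega> in Q.
            real_cond_exp Q (F t) (\<lambda>\<omega>. 1 / Z (t + s) \<omega>) \<omega> =
            1 / Z t \<omega> * real_cond_exp P (F t) (indicator {\<omega> \<in> space P. 0 < Z (t + s) \<omega>}) \<omega>)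
         \<and> supermartingale_on T Q F (\<lambda>t \<omega>. 1 / Z t \<omega>)"
proof -
  interpret P: prob_space P by fact
  have dens: "density_on_subalgebra P Q (F t) (Z t)" if "t \<in> T" for t
    using that sets_eq filtration adapted nonneg density
    by unfold_locales (auto simp: filtration_on_def adapted_on_def)
  have cond_exp: "AE \<omega> in Q. real_cond_exp Q (F s) (\<lambda>\<omega>. 1 / Z t \<omega>) \<omega> =
      1 / Z s \<omega> * real_cond_exp P (F s) (indicator {\<omega> \<in> space P. 0 < Z t \<omega>}) \<omega>"
    if "s \<in> T" "t \<in> T" "s \<le> t" for s t
    using that filtration
    by (intro cond_exp_inverse_density[OF P Q dens dens]) (auto simp: filtration_on_def)
  have add: "t + s \<in> T" "t \<le> t + s" if "s \<in> T" "t \<in> T" for s t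
    using time that by (auto simp: Nats_altdef2 elim!: Nats_cases intro: Nats_add)
  have super: "AE \<omega> in Q. real_cond_exp Q (F s) (\<lambda>\<omega>. 1 / Z t \<omega>) \<omega> \<le> 1 / Z s \<omega>"
    if s: "s \<in> T" and t: "t \<in> T" and st: "s \<le> t" for s t
  proof -
    interpret s: density_on_subalgebra P Q "F s" "Z s" by (rule dens[OF s])
    interpret t: density_on_subalgebra P Q "F t" "Z t" by (rule dens[OF t])
    interpret PF: finite_measure_subalgebra P "F s"
      by unfold_locales (rule s.subalg_P)
    have [measurable]: "Z t \<in> borel_measurable P"
      by (rule measurable_from_subalg[OF t.subalg_P t.measurable_Z])
    define W where
      "W = real_cond_exp P (F s) (indicator {\<omega> \<in> space P. 0 < Z t \<omega>})"
    have [measurable]: "W \<in> borel_measurable (F s)"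
      unfolding W_def by measurable
    have "AE \<omega> in P. W \<omega> \<le> 1"
      unfolding W_def
      by (rule PF.real_cond_exp_le_c)
        (auto intro!: P.integrable_const_bound[where B = 1] split: split_indicator)
    then have "AE \<omega> in Q. W \<omega> \<le> 1"
      by (rule s.AE_transfer[rotated]) measurable
    moreover have "AE \<omega> in Q. 0 \<le> Z s \<omega>"
      by (rule AE_I2) (simp add: s.space_eq s.Z_nonneg)
    ultimately show ?thesis
      using cond_exp[OF s t st]
    proof eventually_elim
      case (elim \<omega>)
      then show ?case
        using mult_left_mono[of "W \<omega>" 1 "1 / Z s \<omega>"] by (simp add: W_def)
    qed
  qed
  have "supermartingale_on T Q F (\<lambda>t \<omega>. 1 / Z t \<omega>)"
    unfolding supermartingale_on_def
  proof (intro conjI ballI impI)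
    show "adapted_on T F (\<lambda>t \<omega>. 1 / Z t \<omega>)"
      using adapted by (auto simp: adapted_on_def)
    show "integrable Q (\<lambda>\<omega>. 1 / Z t \<omega>)" if "t \<in> T" for t
      by (rule density_on_subalgebra.integrable_inverse_density[OF dens[OF that]])
        unfold_locales
  qed (rule super)
  then show ?thesis
    using cond_exp add by blast
qed

end
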